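(* Let $n\geq 3$ be a composite number, let $j$ be a proper divisor of $n$ (that is, $j\mid n$ and $0<j<n$), and let $k=\frac nj$. Then $$\ell^{j}(n)=\{X\in\mathbb{S}^{n-2} : \mathcal{R}_n^j(X)=X\ \text{or}\ \mathcal{R}_n^j(X)=-X\}$$ is homeomorphic to $\mathbb{S}^{j-2}$ if $k$ is odd, and to the disjoint union $\mathbb{S}^{j-2}\sqcup\mathbb{S}^{j-1}$ if $k$ is even.
   Context: $\mathbb{S}^{m}$ denotes the unit sphere in $\mathbb{R}^{m+1}$, with the convention $\mathbb{S}^{-1}=\emptyset$. Let $R_\theta\in GL_2(\mathbb{R})$ be the counterclockwise rotation matrix of angle $\theta$. $\mathcal{R}_n\in GL_{n-1}(\mathbb{R})$ is the block-diagonal matrix with diagonal blocks $R_{1\cdot\frac{2\pi}{n}},R_{2\cdot\frac{2\pi}{n}},\dots,R_{\frac{n-1}{2}\cdot\frac{2\pi}{n}}$ if $n$ is odd, and $R_{1\cdot\frac{2\pi}{n}},R_{2\cdot\frac{2\pi}{n}},\dots,R_{\frac{n-2}{2}\cdot\frac{2\pi}{n}},-1$ if $n$ is even (last block of size $1$). It acts on $\mathbb{S}^{n-2}\subset\mathbb{R}^{n-1}$. *)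

theory Defs
  imports
    "HOL-Analysis.Abstract_Euclidean_Space"
    "HOL-Analysis.Sum_Topology"
    "HOL-Computational_Algebra.Primes"
    "Jordan_Normal_Form.Matrix"
begin

text \<open>
  A point of \<open>m\<close>-dimensional Euclidean space is a function \<open>x :: nat \<Rightarrow> real\<close> with \<open>x i = 0\<close> for
  \<open>i \<ge> m\<close>, as in \<^const>\<open>Euclidean_space\<close>; this allows the dimension to depend on \<open>n\<close> and \<open>j\<close>.
  The index of a sphere is an integer, since the (empty) sphere of dimension \<open>-1\<close> occurs.
\<close>

definition unit_sphere :: "int \<Rightarrow> (nat \<Rightarrow> real) topology" where
  "unit_sphere m = (if m < 0 then trivial_topology else nsphere (nat m))"

definition disjoint_union :: "'a topology \<Rightarrow> 'a topology \<Rightarrow> (bool \<times> 'a) topology" where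
  "disjoint_union X Y = sum_topology (\<lambda>b. if b then Y else X) UNIV"

definition rot :: "real \<Rightarrow> real mat" where
  "rot \<theta> = mat_of_rows_list 2 [[cos \<theta>, - sin \<theta>], [sin \<theta>, cos \<theta>]]"

definition Rn :: "nat \<Rightarrow> real mat" where
  "Rn n = (if odd n
     then diag_block_mat (map (\<lambda>i. rot (real i * (2 * pi / real n))) [1..<(n - 1) div 2 + 1])
     else diag_block_mat (map (\<lambda>i. rot (real i * (2 * pi / real n))) [1..<(n - 2) div 2 + 1]
            @ [mat_of_rows_list 1 [[-1]]]))"

lemma Rn_carrier:
  assumes "n \<ge> 2"
  shows "Rn n \<in> carrier_mat (n - 1) (n - 1)"
proof -
  have d: "dim_row (rot t) = 2" "dim_col (rot t) = 2" for t
    by (simp_all add: rot_def mat_of_rows_list_def)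
  have "dim_row (Rn n) = n - 1 \<and> dim_col (Rn n) = n - 1"
  proof (cases "odd n")
    case True
    then obtain q where "n = 2 * q + 1" by (rule oddE)
    then show ?thesis
      by (simp add: Rn_def dim_diag_block_mat o_def d sum_list_triv)
  next
    case False
    then obtain q where "n = 2 * q" by auto
    with assms obtain r where "n = 2 * Suc r" by (cases q) auto
    then show ?thesis
      by (simp add: Rn_def dim_diag_block_mat o_def d sum_list_triv mat_of_rows_list_def)
  qed
  then show ?thesis by auto
qed

definition mat_act :: "real mat \<Rightarrow> (nat \<Rightarrow> real) \<Rightarrow> (nat \<Rightarrow> real)" where
  "mat_act A x = (\<lambda>i. if i < dim_row A then (A *\<^sub>v vec (dim_col A) x) $ i else 0)"

definition ell :: "nat \<Rightarrow> nat \<Rightarrow> (nat \<Rightarrow> real) set" where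
  "ell j n = {X \<in> topspace (unit_sphere (int n - 2)).
     mat_act (Rn n ^\<^sub>m j) X = X \<or> mat_act (Rn n ^\<^sub>m j) X = - X}"

end

theory Submission
  imports Defs "HOL-Analysis.Complex_Transcendental"
begin

text \<open>
  Grouping the coordinates in pairs turns \<open>\<R>\<^sub>n\<close> into multiplication of the \<open>i\<close>-th complex coordinate by
  \<open>exp (2 \<pi> \<i> i / n)\<close>; for even \<open>n\<close> this also covers the last block \<open>-1\<close>, which acts on the real axis.
  Hence \<open>\<R>\<^sub>n\<^sup>j\<close> multiplies it by \<open>exp (2 \<pi> \<i> i / k)\<close>, so the eigenspaces of \<open>\<R>\<^sub>n\<^sup>j\<close> for \<open>1\<close> and \<open>-1\<close> are the
  coordinate subspaces of the blocks with \<open>k dvd i\<close>, respectively \<open>k dvd 2 * i\<close> and not \<open>k dvd i\<close>. They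
  have dimensions \<open>j - 1\<close> and, for even \<open>k\<close>, \<open>j\<close> (otherwise \<open>0\<close>), and their unit spheres are disjoint
  closed sets.
\<close>

section \<open>Unit spheres of coordinate subspaces\<close>

text \<open>The unit sphere of the span of the axes in \<open>A\<close>, kept in one ambient product
  for all \<open>A\<close>, so that the spheres of both eigenspaces are subsets of the same space.
  For empty \<open>A\<close> the sum is 0 and the set is empty, which matches the sphere of
  dimension -1.\<close>

definition coord_sphere :: "nat set \<Rightarrow> (nat \<Rightarrow> real) set" where
  "coord_sphere A = {x. (\<Sum>p\<in>A. (x p)\<^sup>2) = 1 \<and> (\<forall>p. p \<notin> A \<longrightarrow> x p = 0)}"

text \<open>Counting coordinates instead of the dimension treats the empty sphere,
  \<open>d = 0\<close>, uniformly with the others; \<open>nsphere m\<close> lives on the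
  \<open>m + 1\<close> coordinates up to \<open>m\<close>.\<close>

lemma unit_sphere_eq_coord_sphere:
  "unit_sphere (int d - 1) = subtopology (powertop_real UNIV) (coord_sphere {..<d})"
proof (cases d)
  case 0
  then show ?thesis by (simp add: unit_sphere_def coord_sphere_def)
next
  case (Suc m)
  then show ?thesis
    by (simp add: unit_sphere_def nsphere coord_sphere_def lessThan_Suc_atMost not_le)
qed

lemma unit_sphere_minus_2_eq_coord_sphere:
  assumes "d > 0"
  shows "unit_sphere (int d - 2) = subtopology (powertop_real UNIV) (coord_sphere {..<d - 1})"
proof -
  have "int d - 2 = int (d - 1) - 1" using assms by linarith
  then show ?thesis by (simp only: unit_sphere_eq_coord_sphere)
qed

lemma coord_sphere_mono:
  assumes "A \<subseteq> C" "finite C"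
  shows "coord_sphere A = {x \<in> coord_sphere C. \<forall>p. x p \<noteq> 0 \<longrightarrow> p \<in> A}"
proof -
  have "(\<Sum>p\<in>C. (x p)\<^sup>2) = (\<Sum>p\<in>A. (x p)\<^sup>2)" if "\<forall>p. p \<notin> A \<longrightarrow> x p = 0" for x :: "nat \<Rightarrow> real"
    using that assms by (intro sum.mono_neutral_right) auto
  then have "x \<in> coord_sphere A \<longleftrightarrow> x \<in> coord_sphere C \<and> (\<forall>p. p \<notin> A \<longrightarrow> x p = 0)" for x
    using assms by (force simp: coord_sphere_def)
  then show ?thesis by blast
qed

lemma coord_sphere_disjoint:
  assumes "A \<inter> B = {}"
  shows "coord_sphere A \<inter> coord_sphere B = {}"
proof -
  have False if "x \<in> coord_sphere A" "x \<in> coord_sphere B" for x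
  proof -
    have "x p = 0" for p using that assms by (auto simp: coord_sphere_def)
    with that show False by (simp add: coord_sphere_def)
  qed
  then show ?thesis by blast
qed

lemma closedin_coord_sphere: "closedin (powertop_real UNIV) (coord_sphere A)"
proof -
  have "closed (coord_sphere A)"
    unfolding coord_sphere_def
    by (intro closed_Collect_conj closed_Collect_all closed_Collect_imp closed_Collect_eq
        continuous_intros continuous_on_product_coordinates open_Collect_const)
  then show ?thesis by (simp add: euclidean_product_topology)
qed

lemma continuous_map_reindex:
  assumes "bij_betw \<sigma> A B"
  shows "continuous_map (subtopology (powertop_real UNIV) (coord_sphere B))
           (subtopology (powertop_real UNIV) (coord_sphere A)) (\<lambda>x s. if s \<in> A then x (\<sigma> s) else 0)"
proof -
  have "(\<Sum>s\<in>A. (x (\<sigma> s))\<^sup>2) = (\<Sum>p\<in>B. (x p)\<^sup>2)" for x :: "nat \<Rightarrow> real"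
    by (rule sum.reindex_bij_betw[OF assms])
  moreover have "continuous_map (subtopology (powertop_real UNIV) (coord_sphere B)) euclideanreal
      (\<lambda>x. if s \<in> A then x (\<sigma> s) else 0)" for s
    by (cases "s \<in> A") (auto intro: continuous_map_from_subtopology continuous_map_product_projection)
  ultimately show ?thesis
    by (auto simp: continuous_map_in_subtopology continuous_map_componentwise_UNIV coord_sphere_def)
qed

text \<open>Relabelling coordinates along \<open>\<sigma>\<close> and along its inverse are
  continuous maps. They undo each other because points vanish outside their index set. Hence only
  the cardinality of the index set matters.\<close>

lemma coord_sphere_homeomorphic:
  assumes \<sigma>: "bij_betw \<sigma> A B"
  shows "subtopology (powertop_real UNIV) (coord_sphere A) homeomorphic_space
         subtopology (powertop_real UNIV) (coord_sphere B)"
proof -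
  define \<tau> where "\<tau> = inv_into A \<sigma>"
  have \<tau>: "bij_betw \<tau> B A" unfolding \<tau>_def by (rule bij_betw_inv_into[OF \<sigma>])
  have \<tau>\<sigma>: "\<tau> (\<sigma> s) = s" "\<sigma> s \<in> B" if "s \<in> A" for s
    using that \<sigma> by (auto simp: \<tau>_def bij_betw_inv_into_left bij_betw_apply)
  have \<sigma>\<tau>: "\<sigma> (\<tau> p) = p" "\<tau> p \<in> A" if "p \<in> B" for p
    using that \<sigma> \<tau> by (auto simp: \<tau>_def bij_betw_inv_into_right bij_betw_apply)
  have "homeomorphic_maps (subtopology (powertop_real UNIV) (coord_sphere A))
         (subtopology (powertop_real UNIV) (coord_sphere B))
         (\<lambda>x p. if p \<in> B then x (\<tau> p) else 0) (\<lambda>x s. if s \<in> A then x (\<sigma> s) else 0)"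
    unfolding homeomorphic_maps_def
    using continuous_map_reindex[OF \<sigma>] continuous_map_reindex[OF \<tau>]
    by (auto simp: \<tau>\<sigma> \<sigma>\<tau> coord_sphere_def fun_eq_iff)
  then show ?thesis by (auto simp: homeomorphic_space_def)
qed

text \<open>The two homeomorphisms glue to a continuous map on the sum, injective because
  \<open>U\<close> and \<open>V\<close> are disjoint. It is a closed map: a closed set of the sum
  has a closed image in each of the closed sets \<open>U\<close> and \<open>V\<close>, hence in
  \<open>X\<close>, and a union of two closed sets is closed.\<close>

lemma disjoint_union_homeomorphic_closed_Un:
  assumes U: "closedin X U" and V: "closedin X V" and disj: "U \<inter> V = {}"
    and Y: "Y homeomorphic_space subtopology X U" and Z: "Z homeomorphic_space subtopology X V"
  shows "disjoint_union Y Z homeomorphic_space subtopology X (U \<union> V)"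
proof -
  obtain f g where f: "homeomorphic_map Y (subtopology X U) f"
    and g: "homeomorphic_map Z (subtopology X V) g"
    using Y Z by (auto simp: homeomorphic_space)
  define h where "h = (\<lambda>(b, y). if b then g y else f y)"
  have sub: "U \<subseteq> topspace X" "V \<subseteq> topspace X" using U V closedin_subset by auto
  have fim: "f ` topspace Y = U" and finj: "inj_on f (topspace Y)"
    and gim: "g ` topspace Z = V" and ginj: "inj_on g (topspace Z)"
    using f g sub by (auto simp: homeomorphic_eq_everything_map Int_absorb1)
  have fc: "continuous_map Y X f" and gc: "continuous_map Z X g"
    using f g by (auto simp: homeomorphic_eq_everything_map continuous_map_in_subtopology)
  have fcl: "closed_map Y X f" and gcl: "closed_map Z X g"
    using f g closed_map_from_closed_subtopology[OF U] closed_map_from_closed_subtopology[OF V]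
    by (auto simp: homeomorphic_eq_everything_map)
  have ts: "topspace (disjoint_union Y Z) = {False} \<times> topspace Y \<union> {True} \<times> topspace Z"
    by (auto simp: disjoint_union_def split: if_splits)
  have him: "h ` topspace (disjoint_union Y Z) = U \<union> V"
    unfolding ts using fim gim by (auto simp: h_def image_Un image_iff)
  have "continuous_map (disjoint_union Y Z) X h"
    unfolding continuous_map_def
  proof (intro conjI allI impI)
    show "h \<in> topspace (disjoint_union Y Z) \<rightarrow> topspace X"
      using him sub by blast
    fix W assume W: "openin X W"
    have "openin Y {x \<in> topspace Y. f x \<in> W}" "openin Z {x \<in> topspace Z. g x \<in> W}"
      using fc gc W by (auto simp: continuous_map_def)
    moreover have "{x. (False, x) \<in> {x \<in> topspace (disjoint_union Y Z). h x \<in> W}} = {x \<in> topspace Y. f x \<in> W}"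
      "{x. (True, x) \<in> {x \<in> topspace (disjoint_union Y Z). h x \<in> W}} = {x \<in> topspace Z. g x \<in> W}"
      by (auto simp: ts h_def)
    ultimately show "openin (disjoint_union Y Z) {x \<in> topspace (disjoint_union Y Z). h x \<in> W}"
      unfolding disjoint_union_def openin_sum_topology
      by (auto simp del: topspace_sum_topology) auto
  qed
  then have hc: "continuous_map (disjoint_union Y Z) (subtopology X (U \<union> V)) h"
    using him by (auto simp: continuous_map_in_subtopology)
  have "closed_map (disjoint_union Y Z) X h"
    unfolding closed_map_def
  proof (intro allI impI)
    fix W assume W: "closedin (disjoint_union Y Z) W"
    define W0 W1 where "W0 = {x. (False, x) \<in> W}" and "W1 = {x. (True, x) \<in> W}"
    have "closedin Y W0" "closedin Z W1"
      using W unfolding disjoint_union_def closedin_sum_topology W0_def W1_def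
      by (metis (full_types) UNIV_I)+
    then have "closedin X (f ` W0 \<union> g ` W1)"
      using fcl gcl by (auto simp: closed_map_def)
    moreover have "h ` W = f ` W0 \<union> g ` W1"
      by (force simp: h_def W0_def W1_def image_iff split: if_splits)
    ultimately show "closedin X (h ` W)" by simp
  qed
  then have hcl: "closed_map (disjoint_union Y Z) (subtopology X (U \<union> V)) h"
    by (rule closed_map_into_subtopology) (use him in blast)
  have "inj_on h (topspace (disjoint_union Y Z))"
  proof (rule inj_onI)
    fix u v assume "u \<in> topspace (disjoint_union Y Z)" "v \<in> topspace (disjoint_union Y Z)" "h u = h v"
    moreover have "f y \<noteq> g z" "g z \<noteq> f y" if "y \<in> topspace Y" "z \<in> topspace Z" for y z
      using that fim gim disj by blast+
    ultimately show "u = v"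
      unfolding ts by (auto simp: h_def dest: inj_onD[OF finj] inj_onD[OF ginj])
  qed
  moreover have "h ` topspace (disjoint_union Y Z) = topspace (subtopology X (U \<union> V))"
    using him sub by auto
  ultimately have "homeomorphic_map (disjoint_union Y Z) (subtopology X (U \<union> V)) h"
    using hc hcl by (intro bijective_closed_imp_homeomorphic_map)
  then show ?thesis by (auto simp: homeomorphic_space)
qed

section \<open>The action of the rotation matrix\<close>

lemma index_rot:
  "rot t $$ (0, 0) = cos t" "rot t $$ (0, Suc 0) = - sin t"
  "rot t $$ (Suc 0, 0) = sin t" "rot t $$ (Suc 0, Suc 0) = cos t"
  by (simp_all add: rot_def mat_of_rows_list_def)

lemma dim_rot: "dim_row (rot t) = 2" "dim_col (rot t) = 2"
  by (simp_all add: rot_def mat_of_rows_list_def)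

lemma dim_diag_block_mat_rots:
  "dim_row (diag_block_mat (map (\<lambda>i. rot (f i)) is)) = 2 * length is"
  "dim_col (diag_block_mat (map (\<lambda>i. rot (f i)) is)) = 2 * length is"
  by (simp_all add: dim_diag_block_mat o_def dim_rot sum_list_triv)

text \<open>Induction on the list of blocks. The four cases record whether the row and the column
  meet the first block; removing it shifts an index by 2 and its block by 1.\<close>

lemma index_diag_block_mat_rots:
  assumes "p < 2 * length is" "q < 2 * length is"
  shows "diag_block_mat (map (\<lambda>i. rot (f i)) is) $$ (p, q) =
    (if p div 2 = q div 2 then rot (f (is ! (p div 2))) $$ (p mod 2, q mod 2) else 0)"
  using assms
proof (induction "is" arbitrary: p q)
  case (Cons i "is")
  have small: "r div 2 = 0" "r mod 2 = r" if "r < 2" for r :: nat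
    using that by simp_all
  consider "p < 2" "q < 2" | q' where "p < 2" "q = q' + 2" | p' where "p = p' + 2" "q < 2"
    | p' q' where "p = p' + 2" "q = q' + 2"
    by (metis add.commute le_Suc_ex not_less)
  then show ?case
  proof cases
    case 1
    then show ?thesis by (simp add: Let_def dim_rot small)
  next
    case 2
    then show ?thesis
      using Cons.prems by (simp add: Let_def dim_rot dim_diag_block_mat_rots small)
  next
    case 3
    then show ?thesis
      using Cons.prems by (simp add: Let_def dim_rot dim_diag_block_mat_rots small)
  next
    case 4
    then show ?thesis
      using Cons.prems Cons.IH[of p' q'] by (simp add: Let_def dim_rot dim_diag_block_mat_rots)
  qed
qed simp

text \<open>One formula serves both parities: for even \<open>n\<close> the block number
  \<open>n div 2\<close> has angle \<open>pi\<close>, and its top left entry \<open>cos pi\<close>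
  is the final -1. The rest of that block is cut off by the bounds on \<open>p\<close> and
  \<open>q\<close>.\<close>

lemma index_Rn:
  assumes n: "n \<ge> 2" and p: "p < n - 1" and q: "q < n - 1"
  shows "Rn n $$ (p, q) = (if p div 2 = q div 2
    then rot (real (p div 2 + 1) * (2 * pi / real n)) $$ (p mod 2, q mod 2) else 0)"
proof (cases "odd n")
  case True
  then obtain m where m: "n = 2 * m + 1" by (rule oddE)
  define L where "L = [1..<m + 1]"
  have L: "length L = m" "r < 2 * m \<Longrightarrow> L ! (r div 2) = r div 2 + 1" for r
    unfolding L_def by (simp_all del: upt_Suc)
  have "Rn n = diag_block_mat (map (\<lambda>i. rot (real i * (2 * pi / real n))) L)"
    using m by (simp add: Rn_def L_def)
  then show ?thesis
    using p q m by (simp add: index_diag_block_mat_rots L)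
next
  case False
  then obtain c where "n = 2 * c" by blast
  with n obtain m where m: "n = 2 * m + 2" by (cases c) auto
  define L where "L = [1..<m + 1]"
  define D where "D = diag_block_mat (map (\<lambda>i. rot (real i * (2 * pi / real n))) L)"
  define E :: "real mat" where "E = mat_of_rows_list 1 [[-1]]"
  have R: "Rn n = diag_block_mat (map (\<lambda>i. rot (real i * (2 * pi / real n))) L
      @ [E])"
    using m by (simp add: Rn_def L_def E_def)
  have L: "length L = m" "r < 2 * m \<Longrightarrow> L ! (r div 2) = r div 2 + 1" for r
    unfolding L_def by (simp_all del: upt_Suc)
  have dims: "dim_row D = 2 * m" "dim_col D = 2 * m"
    unfolding D_def dim_diag_block_mat_rots by (simp_all add: L_def)
  have last: "r = 2 * m" if "r < n - 1" "\<not> r < 2 * m" for r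
    using that m by linarith
  have pi: "real (m + 1) * (2 * pi / real n) = pi" using m by (simp add: field_simps)
  have E: "E $$ (0, 0) = -1" "dim_row E = 1" "dim_col E = 1"
    unfolding E_def by (simp_all add: mat_of_rows_list_def)
  have Rpq: "Rn n $$ (p, q) = (if p < 2 * m then if q < 2 * m then D $$ (p, q) else 0
      else if q < 2 * m then 0 else -1)"
    unfolding R diag_block_mat_last Let_def D_def[symmetric]
    using p q m last[OF p] last[OF q] by (auto simp: dims E)
  show ?thesis
  proof (cases "p < 2 * m")
    case p: True
    show ?thesis
    proof (cases "q < 2 * m")
      case True
      with p show ?thesis
        unfolding Rpq D_def by (simp add: index_diag_block_mat_rots L)
    next
      case False
      with p show ?thesis unfolding Rpq using last[OF q] by auto
    qed
  next
    case p': False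
    show ?thesis
    proof (cases "q < 2 * m")
      case True
      with p' show ?thesis unfolding Rpq using last[OF p] by auto
    next
      case False
      have "p = 2 * m" "q = 2 * m" using last p q p' False by auto
      then show ?thesis unfolding Rpq using pi by (simp add: index_rot del: of_nat_add)
    qed
  qed
qed

text \<open>Coordinate \<open>i\<close>, counted from 0, belongs to block \<open>i + 1\<close>. For
  even \<open>n\<close> the last block fills only the real part; the imaginary part is the entry at
  \<open>n - 1\<close>, which is 0 for the vectors considered.\<close>

definition complex_coord :: "(nat \<Rightarrow> real) \<Rightarrow> nat \<Rightarrow> complex" where
  "complex_coord x i = Complex (x (2 * i)) (x (2 * i + 1))"

lemma complex_coord_eq_iff: "(\<forall>i. complex_coord x i = complex_coord y i) \<longleftrightarrow> x = y"
proof
  assume *: "\<forall>i. complex_coord x i = complex_coord y i"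
  show "x = y"
  proof
    fix p
    show "x p = y p"
      using *[rule_format, of "p div 2"]
      by (cases "even p") (auto simp: complex_coord_def elim!: evenE oddE)
  qed
qed simp

lemma complex_coord_uminus: "complex_coord (- x) i = - complex_coord x i"
  by (simp add: complex_coord_def complex_eq_iff)

lemma complex_coord_support: "(\<forall>i. complex_coord x i \<noteq> 0 \<longrightarrow> P i) \<longleftrightarrow> (\<forall>p. x p \<noteq> 0 \<longrightarrow> P (p div 2))"
proof -
  have "(\<forall>p. x p \<noteq> 0 \<longrightarrow> P (p div 2)) \<longleftrightarrow> (\<forall>i. (x (2 * i) \<noteq> 0 \<longrightarrow> P i) \<and> (x (2 * i + 1) \<noteq> 0 \<longrightarrow> P i))"
    (is "?l \<longleftrightarrow> ?r")
  proof
    assume ?l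
    show ?r
    proof
      fix i
      show "(x (2 * i) \<noteq> 0 \<longrightarrow> P i) \<and> (x (2 * i + 1) \<noteq> 0 \<longrightarrow> P i)"
        using \<open>?l\<close>[rule_format, of "2 * i"] \<open>?l\<close>[rule_format, of "2 * i + 1"] by auto
    qed
  next
    assume r: ?r
    show ?l
    proof (intro allI impI)
      fix p assume "x p \<noteq> 0"
      with r[rule_format, of "p div 2"] show "P (p div 2)"
        by (cases "even p") (auto elim!: evenE oddE)
    qed
  qed
  then show ?thesis by (auto simp: complex_coord_def complex_eq_iff)
qed

lemma mat_act_Rn_nth:
  assumes n: "n \<ge> 2" and p: "p < n - 1" and x: "\<And>q. q \<ge> n - 1 \<Longrightarrow> x q = 0"
  defines "M \<equiv> rot (real (p div 2 + 1) * (2 * pi / real n))"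
  shows "mat_act (Rn n) x p =
    M $$ (p mod 2, 0) * x (2 * (p div 2)) + M $$ (p mod 2, 1) * x (2 * (p div 2) + 1)"
proof -
  let ?i = "2 * (p div 2)"
  let ?g = "\<lambda>q. if p div 2 = q div 2 then M $$ (p mod 2, q mod 2) * x q else 0"
  have d: "dim_row (Rn n) = n - 1" "dim_col (Rn n) = n - 1" using Rn_carrier[OF n] by auto
  have "mat_act (Rn n) x p = (\<Sum>q<n-1. Rn n $$ (p, q) * x q)"
    using p by (simp add: mat_act_def d scalar_prod_def atLeast0LessThan)
  also have "\<dots> = (\<Sum>q<n-1. ?g q)"
    using index_Rn[OF n p] by (intro sum.cong) (auto simp: M_def)
  \<comment> \<open>The larger range contains both entries of the block of \<open>p\<close>, even
    when the last block is truncated; the added terms are 0 because \<open>x\<close> vanishes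
    there.\<close>
  also have "\<dots> = (\<Sum>q<n+1. ?g q)"
    by (rule sum.mono_neutral_left) (auto simp: x)
  also have "\<dots> = (\<Sum>q\<in>{?i, ?i + 1}. ?g q)"
    using p by (intro sum.mono_neutral_right) auto
  finally show ?thesis by simp
qed

lemma complex_coord_Rn:
  assumes n: "n \<ge> 2" and x: "\<And>q. q \<ge> n - 1 \<Longrightarrow> x q = 0"
  shows "complex_coord (mat_act (Rn n) x) i =
    cis (real (i + 1) * (2 * pi / real n)) * complex_coord x i"
proof -
  let ?t = "real (i + 1) * (2 * pi / real n)"
  have z: "mat_act (Rn n) x q = 0" if "q \<ge> n - 1" for q
    using that Rn_carrier[OF n] by (auto simp: mat_act_def)
  have e: "mat_act (Rn n) x (2 * i) = cos ?t * x (2 * i) - sin ?t * x (2 * i + 1)"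
    if "2 * i < n - 1"
    using mat_act_Rn_nth[OF n that x] by (simp add: index_rot)
  have o: "mat_act (Rn n) x (2 * i + 1) = sin ?t * x (2 * i) + cos ?t * x (2 * i + 1)"
    if "2 * i + 1 < n - 1"
    using mat_act_Rn_nth[OF n that x] by (simp add: index_rot)
  \<comment> \<open>The cases are a full block, the truncated last block for even \<open>n\<close>,
    and coordinates beyond the dimension, where both sides are 0.\<close>
  consider "2 * i + 1 < n - 1" | "2 * i + 2 = n" | "2 * i \<ge> n - 1" using n by linarith
  then show ?thesis
  proof cases
    case 1
    then show ?thesis using e o by (simp add: complex_coord_def complex_eq_iff)
  next
    case 2
    then have "?t = pi" using n by (auto simp: field_simps)
    then show ?thesis using e 2 z[of "2 * i + 1"] x[of "2 * i + 1"]
      by (simp add: complex_coord_def complex_eq_iff)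
  next
    case 3
    then show ?thesis using z[of "2 * i"] z[of "2 * i + 1"] x[of "2 * i"] x[of "2 * i + 1"]
      by (simp add: complex_coord_def complex_eq_iff)
  qed
qed

lemma mat_act_mult:
  assumes "A \<in> carrier_mat m m" "B \<in> carrier_mat m m"
  shows "mat_act (A * B) x = mat_act A (mat_act B x)"
proof
  fix p
  have "vec m (mat_act B x) = B *\<^sub>v vec m x"
    using assms by (intro eq_vecI) (auto simp: mat_act_def)
  moreover have "(A * B) *\<^sub>v vec m x = A *\<^sub>v (B *\<^sub>v vec m x)"
    using assms by (intro assoc_mult_mat_vec) auto
  ultimately show "mat_act (A * B) x p = mat_act A (mat_act B x) p"
    using assms by (auto simp: mat_act_def)
qed

lemma complex_coord_Rn_pow:
  assumes n: "n \<ge> 2" and x: "\<And>q. q \<ge> n - 1 \<Longrightarrow> x q = 0"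
  shows "complex_coord (mat_act (Rn n ^\<^sub>m m) x) i =
    cis (real (i + 1) * (2 * pi / real n)) ^ m * complex_coord x i"
  using x
proof (induction m arbitrary: x)
  case 0
  have "mat_act (Rn n ^\<^sub>m 0) x = x"
    using Rn_carrier[OF n] 0 by (auto simp: mat_act_def fun_eq_iff)
  then show ?case by simp
next
  case (Suc m)
  note R = Rn_carrier[OF n]
  \<comment> \<open>The induction hypothesis is applied to \<open>mat_act (Rn n) x\<close>, so this
    vector must vanish from \<open>n - 1\<close> on as well.\<close>
  have z: "mat_act (Rn n) x q = 0" if "q \<ge> n - 1" for q
    using that R by (auto simp: mat_act_def)
  have "mat_act (Rn n ^\<^sub>m Suc m) x = mat_act (Rn n ^\<^sub>m m) (mat_act (Rn n) x)"
    using R by (simp add: mat_act_mult[OF pow_carrier_mat[OF R] R])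
  then show ?case
    using Suc.IH[OF z] complex_coord_Rn[OF n Suc.prems] by simp
qed

section \<open>Eigenspaces of the \<open>j\<close>-th power for 1 and -1, and their
  dimensions\<close>

context
  fixes n j k :: nat
  assumes n: "n = k * j" and j: "0 < j" and k: "2 \<le> k"
begin

lemma cis_block_pow:
  "cis (real i * (2 * pi / real n)) ^ j = cis (2 * pi * real i / real k)"
proof -
  have "real j * (real i * (2 * pi / real n)) = 2 * pi * real i / real k"
    unfolding n using j k by (simp add: field_simps)
  then show ?thesis by (simp only: Complex.DeMoivre)
qed

lemma cis_eq_1: "cis (2 * pi * real i / real k) = 1 \<longleftrightarrow> k dvd i"
  using complex_root_unity_eq_1[of k i] k by (simp add: cis_conv_exp mult_ac)

text \<open>A number is -1 exactly if its square is 1 and it is not 1 itself. Squaring doubles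
  \<open>i\<close>, so \<open>cis_eq_1\<close> decides both conditions.\<close>

lemma cis_eq_minus_1: "cis (2 * pi * real i / real k) = -1 \<longleftrightarrow> k dvd 2 * i \<and> \<not> k dvd i"
proof -
  let ?w = "cis (2 * pi * real i / real k)"
  have "real 2 * (2 * pi * real i / real k) = 2 * pi * real (2 * i) / real k" by simp
  then have "?w\<^sup>2 = cis (2 * pi * real (2 * i) / real k)"
    by (simp only: Complex.DeMoivre)
  then have "?w\<^sup>2 = 1 \<longleftrightarrow> k dvd 2 * i" by (simp only: cis_eq_1)
  moreover have "?w\<^sup>2 = 1 \<longleftrightarrow> ?w = 1 \<or> ?w = -1" by (rule power2_eq_1_iff)
  ultimately show ?thesis using cis_eq_1[of i] by auto
qed

text \<open>Both equations decouple into one scalar equation per complex coordinate, which forces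
  the coordinate to be 0 unless its multiplier is 1, respectively -1.\<close>

lemma Rn_pow_fixed_iff:
  assumes x: "\<And>q. q \<ge> n - 1 \<Longrightarrow> x q = 0"
  shows "mat_act (Rn n ^\<^sub>m j) x = x \<longleftrightarrow> (\<forall>p. x p \<noteq> 0 \<longrightarrow> k dvd p div 2 + 1)"
    and "mat_act (Rn n ^\<^sub>m j) x = - x \<longleftrightarrow>
      (\<forall>p. x p \<noteq> 0 \<longrightarrow> k dvd 2 * (p div 2 + 1) \<and> \<not> k dvd p div 2 + 1)"
proof -
  have n2: "n \<ge> 2" using n j mult_le_mono[OF k, of 1 j] by simp
  have c: "complex_coord (mat_act (Rn n ^\<^sub>m j) x) i =
      cis (2 * pi * real (i + 1) / real k) * complex_coord x i" for i
    by (simp only: complex_coord_Rn_pow[OF n2 x] cis_block_pow)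
  have e1: "w * z = z \<longleftrightarrow> z \<noteq> 0 \<longrightarrow> w = 1" for w z :: complex
    by auto
  have "mat_act (Rn n ^\<^sub>m j) x = x \<longleftrightarrow> (\<forall>i. complex_coord x i \<noteq> 0 \<longrightarrow> k dvd i + 1)"
    unfolding complex_coord_eq_iff[symmetric] c e1 cis_eq_1 ..
  then show "mat_act (Rn n ^\<^sub>m j) x = x \<longleftrightarrow> (\<forall>p. x p \<noteq> 0 \<longrightarrow> k dvd p div 2 + 1)"
    by (simp add: complex_coord_support)
  have e: "w * z = - z \<longleftrightarrow> z \<noteq> 0 \<longrightarrow> w = -1" for w z :: complex
    using mult_right_cancel[of z w "-1"] by auto
  have "mat_act (Rn n ^\<^sub>m j) x = - x \<longleftrightarrow>
      (\<forall>i. complex_coord x i \<noteq> 0 \<longrightarrow> k dvd 2 * (i + 1) \<and> \<not> k dvd i + 1)"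
    unfolding complex_coord_eq_iff[symmetric] c complex_coord_uminus e cis_eq_minus_1 ..
  then show "mat_act (Rn n ^\<^sub>m j) x = - x \<longleftrightarrow>
      (\<forall>p. x p \<noteq> 0 \<longrightarrow> k dvd 2 * (p div 2 + 1) \<and> \<not> k dvd p div 2 + 1)"
    by (simp only: complex_coord_support)
qed

text \<open>Here \<open>p div 2 + 1\<close> is the number of the block that contains coordinate
  \<open>p\<close>, counted from 1.\<close>

definition fixed_coords :: "nat set" where
  "fixed_coords = {p. p < n - 1 \<and> k dvd p div 2 + 1}"

definition negated_coords :: "nat set" where
  "negated_coords = {p. p < n - 1 \<and> k dvd 2 * (p div 2 + 1) \<and> \<not> k dvd p div 2 + 1}"

lemma ell_eq_coord_spheres:
  "ell j n = coord_sphere fixed_coords \<union> coord_sphere negated_coords"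
proof -
  have "n > 0" using n j k by simp
  then have S: "topspace (unit_sphere (int n - 2)) = coord_sphere {..<n-1}"
    by (simp add: unit_sphere_minus_2_eq_coord_sphere)
  have z: "x q = 0" if "x \<in> coord_sphere {..<n-1}" "q \<ge> n - 1" for x q
    using that by (simp add: coord_sphere_def)
  have "coord_sphere fixed_coords =
      {x \<in> coord_sphere {..<n-1}. \<forall>p. x p \<noteq> 0 \<longrightarrow> k dvd p div 2 + 1}"
    by (subst coord_sphere_mono[of _ "{..<n-1}"])
      (auto simp: fixed_coords_def coord_sphere_def not_less[symmetric])
  moreover have "coord_sphere negated_coords =
      {x \<in> coord_sphere {..<n-1}. \<forall>p. x p \<noteq> 0 \<longrightarrow> k dvd 2 * (p div 2 + 1) \<and> \<not> k dvd p div 2 + 1}"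
    by (subst coord_sphere_mono[of _ "{..<n-1}"])
      (auto simp: negated_coords_def coord_sphere_def not_less[symmetric])
  moreover have "(mat_act (Rn n ^\<^sub>m j) x = x \<or> mat_act (Rn n ^\<^sub>m j) x = - x) \<longleftrightarrow>
      (\<forall>p. x p \<noteq> 0 \<longrightarrow> k dvd p div 2 + 1) \<or>
      (\<forall>p. x p \<noteq> 0 \<longrightarrow> k dvd 2 * (p div 2 + 1) \<and> \<not> k dvd p div 2 + 1)"
    if "x \<in> coord_sphere {..<n-1}" for x
    by (intro arg_cong2[where f = "(\<or>)"] Rn_pow_fixed_iff z[OF that])
  ultimately show ?thesis
    unfolding ell_def S
    by (simp only: Collect_disj_eq[symmetric] conj_disj_distribL[symmetric] cong: conj_cong)
qed

text \<open>For \<open>e = 1\<close> the left side says \<open>k * c < k * j\<close>, that is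
  \<open>c < j\<close>. In the counts below, \<open>e\<close> is the position inside a
  block.\<close>

lemma mult_add_bit_le_iff: "e \<le> 1 \<Longrightarrow> k * c + e \<le> k * j \<longleftrightarrow> c + e \<le> j"
proof -
  assume e: "e \<le> 1"
  have "k * c + 1 \<le> k * j \<longleftrightarrow> c + 1 \<le> j" using k by (simp add: Suc_le_eq)
  moreover have "k * c \<le> k * j \<longleftrightarrow> c \<le> j" using k by simp
  ultimately show ?thesis using e by (cases e) auto
qed

text \<open>
  Both counts map \<open>2 * m + e\<close> with \<open>e \<in> {0, 1}\<close> to coordinate \<open>e\<close> of the \<open>m\<close>-th block: the blocks with
  eigenvalue \<open>1\<close> are numbered \<open>k * (m + 1)\<close>, those with eigenvalue \<open>-1\<close> are numbered
  \<open>(k div 2) * (2 * m + 1)\<close>.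
\<close>

lemma card_fixed_coords: "card fixed_coords = j - 1"
proof -
  define f where "f = (\<lambda>s. 2 * (k * (s div 2 + 1) - 1) + s mod 2)"
  have fd: "f s div 2 + 1 = k * (s div 2 + 1)" and fm: "f s mod 2 = s mod 2" for s
    using k by (auto simp: f_def)
  have inj: "inj f"
  proof (rule injI)
    fix s t assume "f s = f t"
    then have "k * (s div 2 + 1) = k * (t div 2 + 1)" "s mod 2 = t mod 2"
      using fd[of s] fd[of t] fm[of s] fm[of t] by metis+
    then have "s div 2 = t div 2" "s mod 2 = t mod 2" using k by simp_all
    then show "s = t" by (metis div_mult_mod_eq)
  qed
  have range: "f s < n - 1 \<longleftrightarrow> s < j - 1" for s
  proof -
    have "f s < n - 1 \<longleftrightarrow> f s + 2 \<le> n" by linarith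
    \<comment> \<open>Twice the block number plus the position in the block, with \<open>k\<close>
      factored out for comparison with \<open>n = k * j\<close>. What remains is
      \<open>s + 2 \<le> j\<close>.\<close>
    also have "f s + 2 = k * (2 * (s div 2 + 1)) + s mod 2"
      using fd[of s] fm[of s] div_mult_mod_eq[of "f s" 2] by linarith
    also have "\<dots> \<le> n \<longleftrightarrow> 2 * (s div 2 + 1) + s mod 2 \<le> j"
      unfolding n by (rule mult_add_bit_le_iff) simp
    also have "\<dots> \<longleftrightarrow> s < j - 1" by presburger
    finally show ?thesis .
  qed
  have "p \<in> range f" if p: "k dvd p div 2 + 1" for p
  proof -
    obtain c where c: "p div 2 + 1 = k * c" using p by (auto elim: dvdE)
    then obtain m where m: "c = m + 1" by (cases c) auto
    have "f (2 * m + p mod 2) div 2 + 1 = p div 2 + 1" "f (2 * m + p mod 2) mod 2 = p mod 2"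
      unfolding fd fm using c m by simp_all
    then have "p = f (2 * m + p mod 2)" by (metis add_right_cancel div_mult_mod_eq)
    then show ?thesis by blast
  qed
  moreover have "k dvd f s div 2 + 1" for s unfolding fd by simp
  ultimately have "fixed_coords = {p \<in> range f. p < n - 1}"
    unfolding fixed_coords_def by blast
  also have "\<dots> = f ` {..<j - 1}"
    unfolding image_def lessThan_def using range by blast
  finally show ?thesis using inj by (simp add: card_image inj_on_subset)
qed

lemma card_negated_coords:
  assumes "even k"
  shows "card negated_coords = j"
proof -
  obtain h where h: "k = 2 * h" using assms by blast
  have h0: "h > 0" using h k by simp
  define f where "f = (\<lambda>s. 2 * (h * (2 * (s div 2) + 1) - 1) + s mod 2)"
  have fd: "f s div 2 + 1 = h * (2 * (s div 2) + 1)" and fm: "f s mod 2 = s mod 2" for s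
    using h0 by (auto simp: f_def)
  have inj: "inj f"
  proof (rule injI)
    fix s t assume "f s = f t"
    then have "h * (2 * (s div 2) + 1) = h * (2 * (t div 2) + 1)" "s mod 2 = t mod 2"
      using fd[of s] fd[of t] fm[of s] fm[of t] by metis+
    then have "s div 2 = t div 2" "s mod 2 = t mod 2" using h0 by simp_all
    then show "s = t" by (metis div_mult_mod_eq)
  qed
  have range: "f s < n - 1 \<longleftrightarrow> s < j" for s
  proof -
    have "f s < n - 1 \<longleftrightarrow> f s + 2 \<le> n" by linarith
    also have "f s + 2 = 2 * (h * (2 * (s div 2) + 1)) + s mod 2"
      using fd[of s] fm[of s] div_mult_mod_eq[of "f s" 2] by linarith
    \<comment> \<open>The factor 2 turns \<open>h\<close> into \<open>k\<close>. What remains is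
      \<open>s + 1 \<le> j\<close>, so this eigenspace has one dimension more than the fixed
      one.\<close>
    also have "\<dots> = k * (2 * (s div 2) + 1) + s mod 2"
      using h by simp
    also have "\<dots> \<le> n \<longleftrightarrow> 2 * (s div 2) + 1 + s mod 2 \<le> j"
      unfolding n by (rule mult_add_bit_le_iff) simp
    also have "\<dots> \<longleftrightarrow> s < j" by presburger
    finally show ?thesis .
  qed
  \<comment> \<open>With \<open>k = 2 * h\<close>, the first condition says that \<open>h\<close>
    divides \<open>i\<close> and the second that the quotient is odd.\<close>
  have dvd_iff: "k dvd 2 * i \<and> \<not> k dvd i \<longleftrightarrow> (\<exists>m. i = h * (2 * m + 1))" for i
  proof
    assume *: "k dvd 2 * i \<and> \<not> k dvd i"
    then obtain c where c: "i = h * c" using h by (auto elim: dvdE)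
    with * h have "odd c" by auto
    with c show "\<exists>m. i = h * (2 * m + 1)" by (metis oddE)
  next
    assume "\<exists>m. i = h * (2 * m + 1)"
    then obtain m where m: "i = h * (2 * m + 1)" ..
    have "\<not> h * 2 dvd h * (2 * m + 1)" using h0 unfolding nat_mult_dvd_cancel_disj by simp
    then show "k dvd 2 * i \<and> \<not> k dvd i" using m h by (simp add: mult.commute)
  qed
  have "p \<in> range f" if p: "p div 2 + 1 = h * (2 * m + 1)" for p m
  proof -
    have "f (2 * m + p mod 2) div 2 + 1 = p div 2 + 1" "f (2 * m + p mod 2) mod 2 = p mod 2"
      unfolding fd fm using p by simp_all
    then have "p = f (2 * m + p mod 2)" by (metis add_right_cancel div_mult_mod_eq)
    then show ?thesis by blast
  qed
  moreover have "\<exists>m. f s div 2 + 1 = h * (2 * m + 1)" for s using fd by blast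
  ultimately have "negated_coords = {p \<in> range f. p < n - 1}"
    unfolding negated_coords_def dvd_iff by blast
  also have "\<dots> = f ` {..<j}"
    unfolding image_def lessThan_def using range by blast
  finally show ?thesis using inj by (simp add: card_image inj_on_subset)
qed

text \<open>For odd \<open>k\<close>, -1 is not a \<open>k\<close>-th root of unity; in terms of
  divisibility, the factor 2 can be cancelled.\<close>

lemma negated_coords_odd:
  assumes "odd k"
  shows "negated_coords = {}"
proof -
  have "coprime k 2" using assms by simp
  then have "k dvd i" if "k dvd 2 * i" for i using that coprime_dvd_mult_right_iff by blast
  then show ?thesis unfolding negated_coords_def by blast
qed

end

section \<open>Identification of the eigenspace spheres with standard spheres\<close>

lemma unit_sphere_homeomorphic_coord_sphere:
  assumes "finite A" "card A = d"
  shows "unit_sphere (int d - 1) homeomorphic_space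
         subtopology (powertop_real UNIV) (coord_sphere A)"
proof -
  obtain \<sigma> where "bij_betw \<sigma> {..<d} A"
    using assms ex_bij_betw_nat_finite[of A] by (auto simp: atLeast0LessThan)
  then show ?thesis
    unfolding unit_sphere_eq_coord_sphere by (rule coord_sphere_homeomorphic)
qed

theorem theorem5p8:
  fixes n j k :: nat
  assumes "n \<ge> 3" and "\<not> prime n"
    and "j dvd n" and "0 < j" and "j < n"
    and "k = n div j"
  shows "(odd k \<longrightarrow>
           subtopology (unit_sphere (int n - 2)) (ell j n) homeomorphic_space
             unit_sphere (int j - 2)) \<and>
         (even k \<longrightarrow>
           subtopology (unit_sphere (int n - 2)) (ell j n) homeomorphic_space
             disjoint_union (unit_sphere (int j - 2)) (unit_sphere (int j - 1)))"
proof -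
  have n: "n = k * j" using assms by simp
  \<comment> \<open>Otherwise \<open>n = 0\<close> or \<open>n = j\<close>.\<close>
  have k: "2 \<le> k" using n assms(1,5) by (cases "k = 0 \<or> k = 1") auto
  note nk = n assms(4) k
  let ?A = "fixed_coords n k" and ?B = "negated_coords n k"
  let ?T = "\<lambda>A. subtopology (powertop_real UNIV) (coord_sphere A)"
  have fin: "finite ?A" "finite ?B"
    by (auto simp: fixed_coords_def[OF nk] negated_coords_def[OF nk])
  have ell: "ell j n = coord_sphere ?A \<union> coord_sphere ?B"
    by (rule ell_eq_coord_spheres[OF nk])
  have S: "unit_sphere (int n - 2) = ?T {..<n-1}"
    using assms(1) by (intro unit_sphere_minus_2_eq_coord_sphere) simp
  have "ell j n \<subseteq> coord_sphere {..<n-1}"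
    unfolding ell_def S by auto
  then have L: "subtopology (unit_sphere (int n - 2)) (ell j n) =
      subtopology (powertop_real UNIV) (coord_sphere ?A \<union> coord_sphere ?B)"
    unfolding S ell subtopology_subtopology by (simp add: Int_absorb1)
  \<comment> \<open>The fixed space has dimension \<open>j - 1\<close>, a natural subtraction that
    is exact because \<open>j\<close> is positive. For \<open>j = 1\<close> its sphere is the empty
    one.\<close>
  have "int (j - 1) - 1 = int j - 2" using assms(4) by linarith
  then have A: "unit_sphere (int j - 2) homeomorphic_space ?T ?A"
    using unit_sphere_homeomorphic_coord_sphere[OF fin(1) card_fixed_coords[OF nk]] by (simp only:)
  have "?T ?A homeomorphic_space unit_sphere (int j - 2)"
    using A homeomorphic_space_sym by blast
  \<comment> \<open>For odd \<open>k\<close> there are no negated coordinates, so the union reduces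
    to the sphere of the fixed space.\<close>
  moreover have "coord_sphere ?B = {}" if "odd k"
    using negated_coords_odd[OF nk that] by (simp add: coord_sphere_def)
  moreover have "subtopology (powertop_real UNIV) (coord_sphere ?A \<union> coord_sphere ?B)
      homeomorphic_space disjoint_union (unit_sphere (int j - 2)) (unit_sphere (int j - 1))"
    if "even k"
  proof -
    have B: "unit_sphere (int j - 1) homeomorphic_space ?T ?B"
      using unit_sphere_homeomorphic_coord_sphere[OF fin(2) card_negated_coords[OF nk that]] .
    have "?A \<inter> ?B = {}" by (auto simp: fixed_coords_def[OF nk] negated_coords_def[OF nk])
    from disjoint_union_homeomorphic_closed_Un[OF closedin_coord_sphere closedin_coord_sphere
        coord_sphere_disjoint[OF this] A B]
    show ?thesis using homeomorphic_space_sym by blast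
  qed
  ultimately show ?thesis unfolding L by simp
qed

end
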